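(* Let $S$ be a regular AG-groupoid with left identity that is a left duo, and let $A=(\mu_A,\gamma_A)$ be an intuitionistic fuzzy set of $S$. Then $A$ is an intuitionistic fuzzy right ideal of $S$ if and only if $A$ is an intuitionistic fuzzy bi-ideal of $S$.
   Context: An AG-groupoid is a non-empty set $S$ with a binary operation satisfying the left invertive law $(ab)c=(cb)a$ for all $a,b,c\in S$ (no associativity is assumed). A left identity is an element $e\in S$ with $ea=a$ for all $a\in S$. $S$ is regular if for every $a\in S$ there is $x\in S$ with $a=(ax)a$. A non-empty subset $B\subseteq S$ is a left ideal if $SB\subseteq B$, a right ideal if $BS\subseteq B$, and a two-sided ideal if it is both. $S$ is a left duo if every left ideal of $S$ is a two-sided ideal. An intuitionistic fuzzy set (IFS) of $S$ is a pair $A=(\mu_A,\gamma_A)$ of functions $\mu_A,\gamma_A:S\to[0,1]$ with $0\le \mu_A(x)+\gamma_A(x)\le 1$ for all $x\in S$. An IFS $A$ is an intuitionistic fuzzy right ideal if $\mu_A(xy)\ge\mu_A(x)$ and $\gamma_A(xy)\le\gamma_A(x)$ for all $x,y\in S$. It is an intuitionistic fuzzy AG-subgroupoid if $\mu_A(xy)\ge\min\{\mu_A(x),\mu_A(y)\}$ and $\gamma_A(xy)\le\max\{\gamma_A(x),\gamma_A(y)\}$ for all $x,y\in S$. An intuitionistic fuzzy bi-ideal is an intuitionistic fuzzy AG-subgroupoid with $\mu_A((xa)y)\ge\min\{\mu_A(x),\mu_A(y)\}$ and $\gamma_A((xa)y)\le\max\{\gamma_A(x),\gamma_A(y)\}$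 for all $x,a,y\in S$. *)

theory Defs
  imports Complex_Main
begin

locale ag_groupoid =
  fixes S :: "'a set"
    and mult :: "'a \<Rightarrow> 'a \<Rightarrow> 'a" (infixl "\<cdot>" 70)
  assumes nonempty: "S \<noteq> {}"
    and closed: "\<lbrakk>a \<in> S; b \<in> S\<rbrakk> \<Longrightarrow> a \<cdot> b \<in> S"
    and left_invertive: "\<lbrakk>a \<in> S; b \<in> S; c \<in> S\<rbrakk> \<Longrightarrow> (a \<cdot> b) \<cdot> c = (c \<cdot> b) \<cdot> a"
begin

definition left_identity :: "'a \<Rightarrow> bool" where
  "left_identity e \<longleftrightarrow> e \<in> S \<and> (\<forall>a\<in>S. e \<cdot> a = a)"

definition regular :: bool where
  "regular \<longleftrightarrow> (\<forall>a\<in>S. \<exists>x\<in>S. a = (a \<cdot> x) \<cdot> a)"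

definition left_ideal :: "'a set \<Rightarrow> bool" where
  "left_ideal B \<longleftrightarrow> B \<noteq> {} \<and> B \<subseteq> S \<and> (\<forall>s\<in>S. \<forall>b\<in>B. s \<cdot> b \<in> B)"

definition right_ideal :: "'a set \<Rightarrow> bool" where
  "right_ideal B \<longleftrightarrow> B \<noteq> {} \<and> B \<subseteq> S \<and> (\<forall>b\<in>B. \<forall>s\<in>S. b \<cdot> s \<in> B)"

definition two_sided_ideal :: "'a set \<Rightarrow> bool" where
  "two_sided_ideal B \<longleftrightarrow> left_ideal B \<and> right_ideal B"

definition left_duo :: bool where
  "left_duo \<longleftrightarrow> (\<forall>B. left_ideal B \<longrightarrow> two_sided_ideal B)"

(* Functions from S to [0,1] are total real-valued functions on the ambient type;
   only their values on S are constrained or used. *)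
definition intuitionistic_fuzzy_set :: "('a \<Rightarrow> real) \<Rightarrow> ('a \<Rightarrow> real) \<Rightarrow> bool" where
  "intuitionistic_fuzzy_set \<mu> \<gamma> \<longleftrightarrow>
     \<mu> ` S \<subseteq> {0..1} \<and> \<gamma> ` S \<subseteq> {0..1} \<and> (\<forall>x\<in>S. 0 \<le> \<mu> x + \<gamma> x \<and> \<mu> x + \<gamma> x \<le> 1)"

definition intuitionistic_fuzzy_right_ideal :: "('a \<Rightarrow> real) \<Rightarrow> ('a \<Rightarrow> real) \<Rightarrow> bool" where
  "intuitionistic_fuzzy_right_ideal \<mu> \<gamma> \<longleftrightarrow>
     intuitionistic_fuzzy_set \<mu> \<gamma> \<and>
     (\<forall>x\<in>S. \<forall>y\<in>S. \<mu> (x \<cdot> y) \<ge> \<mu> x \<and> \<gamma> (x \<cdot> y) \<le> \<gamma> x)"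

definition intuitionistic_fuzzy_ag_subgroupoid :: "('a \<Rightarrow> real) \<Rightarrow> ('a \<Rightarrow> real) \<Rightarrow> bool" where
  "intuitionistic_fuzzy_ag_subgroupoid \<mu> \<gamma> \<longleftrightarrow>
     intuitionistic_fuzzy_set \<mu> \<gamma> \<and>
     (\<forall>x\<in>S. \<forall>y\<in>S. \<mu> (x \<cdot> y) \<ge> min (\<mu> x) (\<mu> y) \<and> \<gamma> (x \<cdot> y) \<le> max (\<gamma> x) (\<gamma> y))"

definition intuitionistic_fuzzy_bi_ideal :: "('a \<Rightarrow> real) \<Rightarrow> ('a \<Rightarrow> real) \<Rightarrow> bool" where
  "intuitionistic_fuzzy_bi_ideal \<mu> \<gamma> \<longleftrightarrow>
     intuitionistic_fuzzy_ag_subgroupoid \<mu> \<gamma> \<and>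
     (\<forall>x\<in>S. \<forall>a\<in>S. \<forall>y\<in>S.
        \<mu> ((x \<cdot> a) \<cdot> y) \<ge> min (\<mu> x) (\<mu> y) \<and>
        \<gamma> ((x \<cdot> a) \<cdot> y) \<le> max (\<gamma> x) (\<gamma> y))"

end

end

theory Submission
  imports Defs
begin

(* Only the direction from bi-ideals to right ideals has content. With a left identity, S x is a
   left ideal containing x, so left duo gives x y = s x for some s. Writing x = (x z) x, this yields
   x y = s ((x z) x) = (x z) (s x) = (x z) (x y) = (x x) (z y). Moreover x x = (x x) (x z), so that
   (x x) t = (t (x z)) (x x) = (x (t z)) (x x). Hence x y is of the form (x a) (x x), and a bi-ideal
   takes a value at least as good there as at x. *)

context ag_groupoid
begin

text \<open>The left invertive law, applied outside, then inside to
  \<open>(c \<cdot> d) \<cdot> b\<close>, then outside again, restores the shape with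
  \<open>b\<close> and \<open>c\<close> exchanged.\<close>

lemma medial:
  assumes "a \<in> S" "b \<in> S" "c \<in> S" "d \<in> S"
  shows "(a \<cdot> b) \<cdot> (c \<cdot> d) = (a \<cdot> c) \<cdot> (b \<cdot> d)"
proof -
  have "(a \<cdot> b) \<cdot> (c \<cdot> d) = ((c \<cdot> d) \<cdot> b) \<cdot> a"
    using assms by (intro left_invertive closed)
  also have "\<dots> = ((b \<cdot> d) \<cdot> c) \<cdot> a"
    using assms by (simp add: left_invertive)
  also have "\<dots> = (a \<cdot> c) \<cdot> (b \<cdot> d)"
    using assms by (intro left_invertive closed)
  finally show ?thesis .
qed

lemma left_commute:
  assumes "left_identity e" "a \<in> S" "b \<in> S" "c \<in> S"
  shows "a \<cdot> (b \<cdot> c) = b \<cdot> (a \<cdot> c)"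
  using medial[of e a b c] assms by (simp add: left_identity_def)

text \<open>Prefixing \<open>e\<close> turns the first factor into a product, so the left invertive
  law can interchange the two halves; the medial law then regroups them, and a second interchange
  strips \<open>e\<close> off again.\<close>

lemma paramedial:
  assumes "left_identity e" "a \<in> S" "b \<in> S" "c \<in> S" "d \<in> S"
  shows "(a \<cdot> b) \<cdot> (c \<cdot> d) = (d \<cdot> b) \<cdot> (c \<cdot> a)"
proof -
  have e: "e \<in> S" "\<And>u. u \<in> S \<Longrightarrow> e \<cdot> u = u"
    using assms(1) by (auto simp: left_identity_def)
  have "(a \<cdot> b) \<cdot> (c \<cdot> d) = (e \<cdot> (a \<cdot> b)) \<cdot> (c \<cdot> d)"
    using assms e by (simp add: closed)
  also have "\<dots> = ((c \<cdot> d) \<cdot> (a \<cdot> b)) \<cdot> e"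
    using assms e(1) by (intro left_invertive closed)
  also have "\<dots> = ((c \<cdot> a) \<cdot> (d \<cdot> b)) \<cdot> e"
    using assms by (simp add: medial)
  also have "\<dots> = (e \<cdot> (d \<cdot> b)) \<cdot> (c \<cdot> a)"
    using assms e(1) by (intro left_invertive closed)
  finally show ?thesis
    using assms e by (simp add: closed)
qed

lemma left_ideal_principal:
  assumes "left_identity e" "x \<in> S"
  shows "left_ideal ((\<lambda>s. s \<cdot> x) ` S)"
  unfolding left_ideal_def
proof (intro conjI ballI)
  show "(\<lambda>s. s \<cdot> x) ` S \<noteq> {}"
    using nonempty by simp
  show "(\<lambda>s. s \<cdot> x) ` S \<subseteq> S"
    using assms by (auto simp: closed)
next
  fix s b assume "s \<in> S" "b \<in> (\<lambda>s. s \<cdot> x) ` S"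
  then obtain t where t: "t \<in> S" "b = t \<cdot> x" by blast
  have e: "e \<in> S" "e \<cdot> s = s"
    using assms(1) \<open>s \<in> S\<close> by (auto simp: left_identity_def)
  \<comment> \<open>With \<open>s\<close> read as \<open>e \<cdot> s\<close>, the paramedial law
    carries \<open>x\<close> to the far left, from where the left invertive law throws it to the far
    right. This replaces associativity: the new multiplier of \<open>x\<close> is
    \<open>(t \<cdot> e) \<cdot> s\<close>.\<close>
  have "s \<cdot> (t \<cdot> x) = (x \<cdot> s) \<cdot> (t \<cdot> e)"
    using paramedial[OF assms(1) e(1) \<open>s \<in> S\<close> t(1) assms(2)] e by simp
  also have "\<dots> = ((t \<cdot> e) \<cdot> s) \<cdot> x"
    using assms(2) t(1) e(1) \<open>s \<in> S\<close> by (intro left_invertive closed)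
  finally show "s \<cdot> b \<in> (\<lambda>s. s \<cdot> x) ` S"
    using t e \<open>s \<in> S\<close> by (auto simp: closed)
qed

lemma left_duo_mult_swap:
  assumes "left_identity e" "left_duo" "x \<in> S" "y \<in> S"
  obtains s where "s \<in> S" "x \<cdot> y = s \<cdot> x"
proof -
  have "right_ideal ((\<lambda>s. s \<cdot> x) ` S)"
    using left_ideal_principal[OF assms(1,3)] assms(2)
    by (simp add: left_duo_def two_sided_ideal_def)
  moreover have "x \<in> (\<lambda>s. s \<cdot> x) ` S"
    using assms(1,3) by (force simp: left_identity_def)
  ultimately have "x \<cdot> y \<in> (\<lambda>s. s \<cdot> x) ` S"
    using assms(4) unfolding right_ideal_def by blast
  then show thesis
    using that by blast
qed

lemma regular_left_duo_mult_form:
  assumes "left_identity e" "regular" "left_duo" "x \<in> S" "y \<in> S"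
  obtains a where "a \<in> S" "x \<cdot> y = (x \<cdot> a) \<cdot> (x \<cdot> x)"
proof -
  obtain z where z: "z \<in> S" "x = (x \<cdot> z) \<cdot> x"
    using assms(2,4) by (auto simp: regular_def)
  obtain s where s: "s \<in> S" "x \<cdot> y = s \<cdot> x"
    using left_duo_mult_swap assms(1,3,4,5) .
  define t where "t = z \<cdot> y"
  have t: "t \<in> S"
    using z(1) assms(5) by (simp add: t_def closed)
  have "x \<cdot> y = s \<cdot> ((x \<cdot> z) \<cdot> x)"
    using s(2) z(2) by simp
  \<comment> \<open>Moving \<open>s\<close> next to the last \<open>x\<close> recreates
    \<open>s \<cdot> x\<close>, which is \<open>x \<cdot> y\<close>; so \<open>s\<close> disappears
    again and \<open>y\<close> returns.\<close>
  also have "\<dots> = (x \<cdot> z) \<cdot> (s \<cdot> x)"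
    using left_commute[OF assms(1) s(1) closed[OF assms(4) z(1)] assms(4)] .
  also have "\<dots> = (x \<cdot> x) \<cdot> t"
    unfolding t_def s(2)[symmetric] using medial assms(4,5) z(1) by simp
  finally have xy: "x \<cdot> y = (x \<cdot> x) \<cdot> t" .
  \<comment> \<open>Inverting \<open>(x \<cdot> x) \<cdot> t\<close> directly gives
    \<open>(t \<cdot> x) \<cdot> x\<close>, with \<open>t\<close> in front. The extra factor
    \<open>x \<cdot> z\<close> supplies an \<open>x\<close> that \<open>left_commute\<close> can
    pull ahead of \<open>t\<close>.\<close>
  have "x \<cdot> x = ((x \<cdot> z) \<cdot> x) \<cdot> x"
    using z(2) by simp
  also have "\<dots> = (x \<cdot> x) \<cdot> (x \<cdot> z)"
    using assms(4) z(1) by (intro left_invertive closed)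
  finally have "(x \<cdot> x) \<cdot> t = ((x \<cdot> x) \<cdot> (x \<cdot> z)) \<cdot> t"
    by simp
  also have "\<dots> = (t \<cdot> (x \<cdot> z)) \<cdot> (x \<cdot> x)"
    using assms(4) z(1) t by (intro left_invertive closed)
  also have "\<dots> = (x \<cdot> (t \<cdot> z)) \<cdot> (x \<cdot> x)"
    using left_commute[OF assms(1) t assms(4) z(1)] by simp
  finally show thesis
    using that[of "t \<cdot> z"] xy t z(1) by (simp add: closed)
qed

text \<open>Both products arise from \<open>x\<close> by right multiplications, so the value at
  \<open>x\<close> alone is already a bound, and the minimum or maximum with the value at
  \<open>y\<close> only weakens it.\<close>

lemma right_ideal_imp_bi_ideal:
  assumes "intuitionistic_fuzzy_right_ideal \<mu> \<gamma>"
  shows "intuitionistic_fuzzy_bi_ideal \<mu> \<gamma>"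
proof -
  have right: "\<mu> x \<le> \<mu> (x \<cdot> y)" "\<gamma> (x \<cdot> y) \<le> \<gamma> x" if "x \<in> S" "y \<in> S" for x y
    using assms that by (auto simp: intuitionistic_fuzzy_right_ideal_def)
  have "\<mu> x \<le> \<mu> ((x \<cdot> a) \<cdot> y)" "\<gamma> ((x \<cdot> a) \<cdot> y) \<le> \<gamma> x" if "x \<in> S" "a \<in> S" "y \<in> S" for x a y
    using right[of x a] right[of "x \<cdot> a" y] that by (auto simp: closed)
  with right assms show ?thesis
    by (simp add: intuitionistic_fuzzy_bi_ideal_def intuitionistic_fuzzy_ag_subgroupoid_def
        intuitionistic_fuzzy_right_ideal_def min.coboundedI1 max.coboundedI1)
qed

lemma bi_ideal_imp_right_ideal:
  assumes "left_identity e" "regular" "left_duo" "intuitionistic_fuzzy_bi_ideal \<mu> \<gamma>"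
  shows "intuitionistic_fuzzy_right_ideal \<mu> \<gamma>"
  unfolding intuitionistic_fuzzy_right_ideal_def
proof (intro conjI ballI)
  show "intuitionistic_fuzzy_set \<mu> \<gamma>"
    using assms(4)
    by (simp add: intuitionistic_fuzzy_bi_ideal_def intuitionistic_fuzzy_ag_subgroupoid_def)
next
  fix x y assume xy: "x \<in> S" "y \<in> S"
  obtain a where a: "a \<in> S" "x \<cdot> y = (x \<cdot> a) \<cdot> (x \<cdot> x)"
    using regular_left_duo_mult_form assms(1-3) xy .
  \<comment> \<open>In the subgroupoid condition with equal arguments, minimum and maximum
    collapse.\<close>
  have "\<mu> x \<le> \<mu> (x \<cdot> x)" "\<gamma> (x \<cdot> x) \<le> \<gamma> x"
    using assms(4) xy(1)
    by (fastforce simp: intuitionistic_fuzzy_bi_ideal_def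
        intuitionistic_fuzzy_ag_subgroupoid_def)+
  \<comment> \<open>The bi-ideal condition with outer factors \<open>x\<close> and
    \<open>x \<cdot> x\<close> and middle factor \<open>a\<close>.\<close>
  moreover have "min (\<mu> x) (\<mu> (x \<cdot> x)) \<le> \<mu> (x \<cdot> y)" "\<gamma> (x \<cdot> y) \<le> max (\<gamma> x) (\<gamma> (x \<cdot> x))"
    using assms(4) a xy(1) by (simp_all add: intuitionistic_fuzzy_bi_ideal_def closed)
  ultimately show "\<mu> x \<le> \<mu> (x \<cdot> y)" "\<gamma> (x \<cdot> y) \<le> \<gamma> x"
    by simp_all
qed

end

theorem theorem5:
  fixes S :: "'a set"
    and mult :: "'a \<Rightarrow> 'a \<Rightarrow> 'a"
    and \<mu> \<gamma> :: "'a \<Rightarrow> real"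
  assumes "ag_groupoid S mult"
    and "\<exists>e. ag_groupoid.left_identity S mult e"
    and "ag_groupoid.regular S mult"
    and "ag_groupoid.left_duo S mult"
    and "ag_groupoid.intuitionistic_fuzzy_set S \<mu> \<gamma>"
  shows "ag_groupoid.intuitionistic_fuzzy_right_ideal S mult \<mu> \<gamma> \<longleftrightarrow>
         ag_groupoid.intuitionistic_fuzzy_bi_ideal S mult \<mu> \<gamma>"
  using assms(2-4) ag_groupoid.right_ideal_imp_bi_ideal[OF assms(1)]
    ag_groupoid.bi_ideal_imp_right_ideal[OF assms(1)] by blast

end
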